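(* Assume $\phi=\tanh$ in a full residual network (FRN), and let $\chi^{(l)}$ be the mean-field squared gradient norm at layer $l$. (1) If $\sigma_w=0$, then $\chi^{(m)}=\chi^{(l)}$ for all $l,m$. (2) If $\sigma_w>0$, then for $l\ge m\ge1$, $$\log(\chi^{(m)}/\chi^{(l)})=\mathcal A(\sqrt l-\sqrt m)+\mathcal B(\log l-\log m)+O(1),$$ where $$\mathcal A=\frac43\sqrt{\frac2\pi}\,\frac{\sigma_v^2\sigma_w}{\sqrt{\sigma_v^2+\sigma_a^2}},\qquad \mathcal B=\frac4{9\pi}\,\frac{\sigma_v^4}{\sigma_v^2+\sigma_a^2}\Big(\frac3{\sigma_v^2+\sigma_a^2}-\sigma_w^2\Big).$$
   Context: Put $\mathrm V f(q)=\mathbb E[f(z)^2]$, $z\sim\mathcal N(0,q)$, and $\dot\phi=\phi'$. An FRN of width $N$ has layers $x^{(l)}_i=\sum_jv^{(l)}_{ij}\phi(h^{(l)}_j)+x^{(l-1)}_i+a^{(l)}_i$, $h^{(l)}_i=\sum_jw^{(l)}_{ij}x^{(l-1)}_j+b^{(l)}_i$ with independent Gaussian parameters of mean $0$ and variances $\sigma_v^2/N$, $\sigma_a^2$, $\sigma_w^2/N$, $\sigma_b^2$ respectively for $v,a,w,b$. Its mean-field ($N\to\infty$) length quantities are determined by $p^{(0)}=\|x^{(0)}\|^2/N$ and, for $l\ge1$, $q^{(l)}=\sigma_w^2p^{(l-1)}+\sigma_b^2$, $p^{(l)}=\sigma_v^2\,\mathrm V\phi(q^{(l)})+\sigma_a^2+p^{(l-1)}$.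 For a loss $E$, the mean-field gradient quantity $\chi^{(l)}=\langle(\partial E/\partial x_1^{(l)})^2\rangle$ (computed with backward weights independent of the forward ones, and gradients independent of the activations of the previous layer) is determined by its value at the last layer and the backward recurrence $$\chi^{(l-1)}=(\sigma_v^2\sigma_w^2\,\mathrm V\dot\phi(q^{(l)})+1)\,\chi^{(l)}.$$
   Formalization: Part (2) additionally assumes that p^(0), σ_a, σ_b are not all zero; if all vanish, q^(l)=0 at every layer and log(χ^(m)/χ^(l)) = (l−m)·log(σ_v²σ_w²+1), so the claim fails for σ_v>0 (and A, B are undefined for σ_v=0). *)

theory Defs
  imports "HOL-Probability.Probability"
begin

text \<open>
  The law \<open>N(0,q)\<close> is the image of the standard normal law under scaling by \<open>sqrt q\<close>, so that
  \<open>q = 0\<close> gives the point mass at \<open>0\<close>; \<open>density lborel (normal_density 0 0)\<close> would be the zero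
  measure.
\<close>
definition centered_normal :: "real \<Rightarrow> real measure" where
  "centered_normal q = distr (density lborel std_normal_density) borel (\<lambda>z. sqrt q * z)"

definition V_op :: "(real \<Rightarrow> real) \<Rightarrow> real \<Rightarrow> real" where
  "V_op f q = (LINT z | centered_normal q. (f z)\<^sup>2)"

text \<open>
  Mean-field length quantities of a full residual network with activation \<open>\<phi>\<close>. The parameters
  \<open>\<sigma>v \<sigma>a \<sigma>w \<sigma>b\<close> are standard deviations (up to the width normalisation), and \<open>p0\<close> is the
  normalised squared length of the input. The argument of \<open>V_op \<phi>\<close> in \<open>frn_p\<close> is
  \<open>frn_q\<close> at layer \<open>Suc l\<close>; \<open>frn_q\<close> is meaningful from layer 1 on.
\<close>
primrec frn_p ::
    "(real \<Rightarrow> real) \<Rightarrow> real \<Rightarrow> real \<Rightarrow> real \<Rightarrow> real \<Rightarrow> real \<Rightarrow> nat \<Rightarrow> real" where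
  "frn_p \<phi> \<sigma>v \<sigma>a \<sigma>w \<sigma>b p0 0 = p0"
| "frn_p \<phi> \<sigma>v \<sigma>a \<sigma>w \<sigma>b p0 (Suc l) =
     \<sigma>v\<^sup>2 * V_op \<phi> (\<sigma>w\<^sup>2 * frn_p \<phi> \<sigma>v \<sigma>a \<sigma>w \<sigma>b p0 l + \<sigma>b\<^sup>2) + \<sigma>a\<^sup>2 + frn_p \<phi> \<sigma>v \<sigma>a \<sigma>w \<sigma>b p0 l"

definition frn_q ::
    "(real \<Rightarrow> real) \<Rightarrow> real \<Rightarrow> real \<Rightarrow> real \<Rightarrow> real \<Rightarrow> real \<Rightarrow> nat \<Rightarrow> real" where
  "frn_q \<phi> \<sigma>v \<sigma>a \<sigma>w \<sigma>b p0 l = \<sigma>w\<^sup>2 * frn_p \<phi> \<sigma>v \<sigma>a \<sigma>w \<sigma>b p0 (l - 1) + \<sigma>b\<^sup>2"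

text \<open>
  \<open>chi\<close> is the mean-field squared gradient sequence of a network with layers \<open>0, \<dots>, L\<close>: on these
  layers it is determined by \<open>chi L\<close>, which depends on the loss and is left free. Values of \<open>chi\<close>
  beyond \<open>L\<close> are irrelevant.
\<close>
definition frn_gradient ::
    "(real \<Rightarrow> real) \<Rightarrow> real \<Rightarrow> real \<Rightarrow> real \<Rightarrow> real \<Rightarrow> real \<Rightarrow> nat \<Rightarrow> (nat \<Rightarrow> real) \<Rightarrow> bool" where
  "frn_gradient \<phi> \<sigma>v \<sigma>a \<sigma>w \<sigma>b p0 L chi \<longleftrightarrow>
     (\<forall>l\<in>{1..L}. chi (l - 1) =
        (\<sigma>v\<^sup>2 * \<sigma>w\<^sup>2 * V_op (deriv \<phi>) (frn_q \<phi> \<sigma>v \<sigma>a \<sigma>w \<sigma>b p0 l) + 1) * chi l)"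

end

theory Submission
  imports Defs "HOL-Real_Asymp.Real_Asymp"
begin

text \<open>
  Since the integral of \<open>sech\<^sup>2\<close> is \<open>2\<close> and that of \<open>sech\<^sup>4\<close> is \<open>4/3\<close>, flattening the Gaussian
  density gives \<open>V tanh q = 1 - \<kappa> / sqrt q\<close> and \<open>V tanh' q = (2/3) \<kappa> / sqrt q\<close> up to \<open>O(q powr (-3/2))\<close>,
  where \<open>\<kappa> = sqrt (2 / pi)\<close>. Instead of expanding \<open>q\<close> in the layer index to second order, one finds
  a potential \<open>F(q) = c sqrt q + d ln q\<close> whose increment along one layer agrees with the logarithm
  of the gradient factor up to \<open>O(q powr (-3/2))\<close>. Because \<open>q\<close> grows linearly these errors are summable
  and the sum telescopes; then \<open>q = k l + O(sqrt l)\<close> suffices to replace \<open>F(q)\<close> by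
  \<open>A sqrt l + B ln l\<close> up to a bounded error.
\<close>

subsection \<open>Gaussian averages of tanh\<close>

lemma tanh_square_le_1: "(tanh (x::real))\<^sup>2 \<le> 1"
  using tanh_real_bounds[of x] by (auto simp: abs_square_le_1)

text \<open>For a nonnegative integrand, finite limits of the antiderivative at both ends give
  integrability along with the value, so no separate domination argument is needed.\<close>

lemma has_bochner_integral_FTC_UNIV_nonneg:
  fixes f F :: "real \<Rightarrow> real"
  assumes "\<And>x. (F has_real_derivative f x) (at x)" "\<And>x. isCont f x" "\<And>x. 0 \<le> f x"
    and "(F \<longlongrightarrow> A) at_bot" "(F \<longlongrightarrow> B) at_top"
  shows "has_bochner_integral lborel f (B - A)"
proof -
  have bot: "((F \<circ> real_of_ereal) \<longlongrightarrow> A) (at_right (-\<infinity>))"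
    using assms(4) by (simp add: ereal_tendsto_simps1)
  have top: "((F \<circ> real_of_ereal) \<longlongrightarrow> B) (at_left \<infinity>)"
    using assms(5) by (simp add: ereal_tendsto_simps1)
  have "set_integrable lborel (einterval (-\<infinity>) \<infinity>) f"
    "(LBINT x=-\<infinity>..\<infinity>. f x) = B - A"
    using assms by (intro interval_integral_FTC_nonneg[OF _ _ _ _ bot top]; simp)+
  then show ?thesis
    by (simp add: has_bochner_integral_iff set_integrable_def interval_lebesgue_integral_def
        set_lebesgue_integral_def)
qed

section \<open>Integrals and moments of powers of sech\<close>

lemma has_bochner_integral_sech_square:
  "has_bochner_integral lborel (\<lambda>x::real. 1 - (tanh x)\<^sup>2) 2"
proof -
  have "has_bochner_integral lborel (\<lambda>x::real. 1 - (tanh x)\<^sup>2) (1 - (- 1))"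
  proof (rule has_bochner_integral_FTC_UNIV_nonneg[where F = tanh])
    show "(tanh has_real_derivative 1 - (tanh x)\<^sup>2) (at x)" for x :: real
      by (auto intro!: derivative_eq_intros)
    show "isCont (\<lambda>x. 1 - (tanh x)\<^sup>2) x" for x :: real
      by (intro continuous_intros) auto
    show "0 \<le> 1 - (tanh x)\<^sup>2" for x :: real
      using tanh_square_le_1[of x] by simp
  qed (rule tanh_real_at_bot tanh_real_at_top)+
  then show ?thesis by simp
qed

lemma has_bochner_integral_sech_power4:
  "has_bochner_integral lborel (\<lambda>x::real. (1 - (tanh x)\<^sup>2)\<^sup>2) (4 / 3)"
proof -
  \<comment> \<open>Substituting t = tanh x, dt = (1 - t^2) dx turns the integrand into 1 - t^2,
    with antiderivative t - t^3/3.\<close>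
  let ?F = "\<lambda>x::real. tanh x - (tanh x) ^ 3 / 3"
  have "has_bochner_integral lborel (\<lambda>x::real. (1 - (tanh x)\<^sup>2)\<^sup>2) ((1 - 1 ^ 3 / 3) - (- 1 - (- 1) ^ 3 / 3))"
  proof (rule has_bochner_integral_FTC_UNIV_nonneg[where F = ?F])
    show "(?F has_real_derivative (1 - (tanh x)\<^sup>2)\<^sup>2) (at x)" for x :: real
      by (auto intro!: derivative_eq_intros) (simp add: algebra_simps power2_eq_square)
    show "isCont (\<lambda>x. (1 - (tanh x)\<^sup>2)\<^sup>2) x" for x :: real
      by (intro continuous_intros) auto
    show "(?F \<longlongrightarrow> (- 1 - (- 1) ^ 3 / 3)) at_bot"
      by (intro tendsto_intros tanh_real_at_bot) auto
    show "(?F \<longlongrightarrow> (1 - 1 ^ 3 / 3)) at_top"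
      by (intro tendsto_intros tanh_real_at_top) auto
  qed auto
  then show ?thesis by simp
qed

text \<open>Half of the exponential decay pays for the factor x^2: x^2 <= 4 cosh x and cosh(x/2)^2
  <= cosh x. What remains is sech squared in a rescaled variable, whose integrability is
  known.\<close>

lemma sech_square_moment_bound:
  fixes x :: real
  shows "x\<^sup>2 * (1 - (tanh x)\<^sup>2) \<le> 4 * (1 - (tanh (x / 2))\<^sup>2)"
proof -
  have sech: "1 - (tanh y)\<^sup>2 = 1 / (cosh y)\<^sup>2" for y :: real
  proof -
    have "1 - (tanh y)\<^sup>2 = ((cosh y)\<^sup>2 - (sinh y)\<^sup>2) / (cosh y)\<^sup>2"
      using cosh_real_pos[of y] by (simp add: tanh_def power_divide diff_divide_distrib)
    then show ?thesis by (simp add: cosh_square_eq)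
  qed
  have "1 + \<bar>x\<bar> + \<bar>x\<bar>\<^sup>2 / 2 \<le> exp \<bar>x\<bar>"
    by (rule exp_lower_Taylor_quadratic) simp
  moreover have "1 - \<bar>x\<bar> \<le> exp (- \<bar>x\<bar>)"
    using exp_ge_add_one_self[of "- \<bar>x\<bar>"] by simp
  moreover have "cosh x = (exp \<bar>x\<bar> + exp (- \<bar>x\<bar>)) / 2"
    by (simp add: cosh_field_def abs_if)
  \<comment> \<open>Adding the two exponential bounds cancels the terms linear in |x| and leaves
    cosh x >= 1 + x^2/4.\<close>
  ultimately have quad: "x\<^sup>2 \<le> 4 * cosh x"
    by simp
  have "(cosh (x / 2))\<^sup>2 \<le> cosh x"
    using cosh_square_eq[of "x / 2"] cosh_double_cosh[of "x / 2"] by simp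
  then have "x\<^sup>2 * (cosh (x / 2))\<^sup>2 \<le> (4 * cosh x) * cosh x"
    using quad by (intro mult_mono) auto
  moreover have "0 < cosh x" "0 < cosh (x / 2)"
    by simp_all
  ultimately show ?thesis
    unfolding sech by (simp add: field_simps power2_eq_square)
qed

lemma integrable_sech_square_moment:
  "integrable lborel (\<lambda>x::real. x\<^sup>2 * (1 - (tanh x)\<^sup>2))"
proof (rule Bochner_Integration.integrable_bound)
  show "integrable lborel (\<lambda>x::real. 4 * (1 - (tanh (x / 2))\<^sup>2))"
    using lborel_integrable_real_affine[of "\<lambda>x. 1 - (tanh x)\<^sup>2" "1 / 2" 0]
      has_bochner_integral_sech_square
    by (intro integrable_mult_right) (simp add: has_bochner_integral_iff)
  show "AE x in lborel. norm (x\<^sup>2 * (1 - (tanh x)\<^sup>2)) \<le> norm (4 * (1 - (tanh (x / 2 :: real))\<^sup>2))"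
  proof (intro always_eventually allI)
    fix x :: real
    have "0 \<le> 1 - (tanh y)\<^sup>2" for y :: real
      using tanh_square_le_1[of y] by simp
    from this[of x] this[of "x / 2"]
    show "norm (x\<^sup>2 * (1 - (tanh x)\<^sup>2)) \<le> norm (4 * (1 - (tanh (x / 2 :: real))\<^sup>2))"
      using sech_square_moment_bound[of x] by (simp add: abs_mult)
  qed
qed (auto intro!: borel_measurable_continuous_onI continuous_intros)

section \<open>Gaussian averages at large variance\<close>

lemma integral_centered_normal:
  assumes [measurable]: "f \<in> borel_measurable borel"
  shows "(LINT z | centered_normal q. f z) = (LINT z | lborel. std_normal_density z * f (sqrt q * z))"
  unfolding centered_normal_def
  by (subst integral_distr) (auto simp: integral_density)

text \<open>After x = sqrt q * z the weight is the density of N(0,q), and \<open>c\<close> is its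
  peak value. The weight never exceeds \<open>c\<close>, which gives the upper bound; by 1 - exp(-u)
  <= u it falls short of \<open>c\<close> by at most c * x^2/(2q), which costs a second moment of
  \<open>g\<close>.\<close>

lemma gaussian_mean_approx:
  fixes g :: "real \<Rightarrow> real"
  assumes q: "q > 0" and g0: "\<And>x. 0 \<le> g x" and g: "integrable lborel g"
    and g2: "integrable lborel (\<lambda>x. x\<^sup>2 * g x)"
  defines "E \<equiv> (LINT z | lborel. std_normal_density z * g (sqrt q * z))"
  defines "c \<equiv> 1 / sqrt (2 * pi * q)"
  shows "E \<le> c * (LINT x | lborel. g x)"
    and "c * (LINT x | lborel. g x) - E \<le> c * (LINT x | lborel. x\<^sup>2 * g x) / (2 * q)"
    and "0 \<le> E" "integrable lborel (\<lambda>z. std_normal_density z * g (sqrt q * z))"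
proof -
  \<comment> \<open>The extra factor \<open>sqrt q\<close> makes the pullback of \<open>h\<close>
    along z -> sqrt q * z equal to the integrand of \<open>E\<close> itself, with no Jacobian left
    over.\<close>
  define h where "h x = sqrt q * (c * exp (- x\<^sup>2 / (2 * q)) * g x)" for x
  have c: "c > 0" "c * sqrt q = 1 / sqrt (2 * pi)"
    using q by (auto simp: c_def real_sqrt_mult)
  have hE: "h (0 + sqrt q * z) = std_normal_density z * g (sqrt q * z)" for z
    using q by (simp add: h_def std_normal_density_def power_mult_distrib flip: c(2))
  have ex: "c * exp (- x\<^sup>2 / (2 * q)) * g x \<le> c * g x" for x
    using q g0[of x] c(1) by (intro mult_right_mono) auto
  have int: "integrable lborel (\<lambda>x. c * exp (- x\<^sup>2 / (2 * q)) * g x)"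
  proof (rule Bochner_Integration.integrable_bound)
    show "integrable lborel (\<lambda>x. c * g x)" using g by simp
    show "AE x in lborel. norm (c * exp (- x\<^sup>2 / (2 * q)) * g x) \<le> norm (c * g x)"
      using g0 c ex by (intro always_eventually allI) (simp add: abs_mult)
  qed (use g in measurable)
  have inth: "integrable lborel h"
    unfolding h_def using int by simp
  have "(LINT x | lborel. h x) = sqrt q * E"
    using q unfolding E_def by (subst lborel_integral_real_affine[where c = "sqrt q" and t = 0]) (auto simp: hE simp del: add_0)
  then have E: "E = (LINT x | lborel. c * exp (- x\<^sup>2 / (2 * q)) * g x)"
    using q by (simp add: h_def[abs_def])
  show "integrable lborel (\<lambda>z. std_normal_density z * g (sqrt q * z))"
    using lborel_integrable_real_affine[OF inth, of "sqrt q" 0] q unfolding hE by simp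
  show "0 \<le> E"
    unfolding E_def using g0 by (intro Bochner_Integration.integral_nonneg) (simp add: std_normal_density_def)
  have "E \<le> (LINT x | lborel. c * g x)"
    unfolding E using int g ex by (intro integral_mono) auto
  then show "E \<le> c * (LINT x | lborel. g x)" by simp
  have "(LINT x | lborel. c * g x) - E = (LINT x | lborel. c * g x - c * exp (- x\<^sup>2 / (2 * q)) * g x)"
    unfolding E using int g by simp
  also have "\<dots> \<le> (LINT x | lborel. c * (x\<^sup>2 * g x) / (2 * q))"
  proof (intro integral_mono)
    show "c * g x - c * exp (- x\<^sup>2 / (2 * q)) * g x \<le> c * (x\<^sup>2 * g x) / (2 * q)" for x
    proof -
      have "1 - exp (- x\<^sup>2 / (2 * q)) \<le> x\<^sup>2 / (2 * q)"
        using exp_ge_add_one_self[of "- x\<^sup>2 / (2 * q)"] by simp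
      then have "(c * g x) * (1 - exp (- x\<^sup>2 / (2 * q))) \<le> (c * g x) * (x\<^sup>2 / (2 * q))"
        using c g0[of x] by (intro mult_left_mono) auto
      then show ?thesis by (simp add: algebra_simps)
    qed
  qed (use int g g2 in auto)
  finally show "c * (LINT x | lborel. g x) - E \<le> c * (LINT x | lborel. x\<^sup>2 * g x) / (2 * q)"
    by simp
qed

text \<open>Expresses the peak of the density through sqrt(2/pi). The remaining factor 1/2 meets the
  integrals 2 and 4/3, producing the coefficients 1 and 2/3 of the two expansions.\<close>

lemma inverse_sqrt_two_pi_mult: "1 / sqrt (2 * pi * q) = sqrt (2 / pi) / sqrt q / 2"
proof -
  have "2 / pi / 4 = 1 / (2 * pi)" by simp
  then have "sqrt (2 / pi) / 2 = 1 / sqrt (2 * pi)"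
    using real_sqrt_divide[of "2 / pi" 4] real_sqrt_divide[of 1 "2 * pi"] by (metis real_sqrt_four real_sqrt_one)
  then show ?thesis by (simp add: real_sqrt_mult)
qed

lemma integrable_gaussian_sech_square:
  assumes "q > 0"
  shows "integrable lborel (\<lambda>z. std_normal_density z * (1 - (tanh (sqrt q * z))\<^sup>2))"
  by (rule gaussian_mean_approx(4)[OF assms, of "\<lambda>x. 1 - (tanh x)\<^sup>2"])
    (use has_bochner_integral_sech_square integrable_sech_square_moment in
        \<open>auto simp: has_bochner_integral_iff tanh_square_le_1\<close>)

text \<open>The square of tanh is not integrable over the line, so
  \<open>gaussian_mean_approx\<close> does not apply to it directly; its complement sech squared is
  integrable, and the normal law has mass 1.\<close>

lemma one_minus_V_op_tanh:
  assumes "q > 0"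
  shows "1 - V_op tanh q = (LINT z | lborel. std_normal_density z * (1 - (tanh (sqrt q * z))\<^sup>2))"
proof -
  have n: "integrable lborel std_normal_density" "(LINT z | lborel. std_normal_density z) = 1"
    by auto
  note i = integrable_gaussian_sech_square[OF assms]
  have "V_op tanh q = (LINT z | lborel. std_normal_density z * (tanh (sqrt q * z))\<^sup>2)"
    unfolding V_op_def by (rule integral_centered_normal)
      (auto intro!: borel_measurable_continuous_onI continuous_intros)
  also have "\<dots> = (LINT z | lborel. std_normal_density z
      - std_normal_density z * (1 - (tanh (sqrt q * z))\<^sup>2))"
    by (simp add: algebra_simps)
  also have "\<dots> = 1 - (LINT z | lborel. std_normal_density z * (1 - (tanh (sqrt q * z))\<^sup>2))"
    using n i by (subst Bochner_Integration.integral_diff) auto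
  finally show ?thesis by simp
qed

lemma V_op_tanh_bounds:
  assumes "q > 0"
  shows "V_op tanh q \<le> 1" "1 - V_op tanh q \<le> sqrt (2 / pi) / sqrt q"
proof -
  have g: "0 \<le> 1 - (tanh x)\<^sup>2" for x :: real
    using tanh_square_le_1[of x] by simp
  have i: "integrable lborel (\<lambda>x::real. 1 - (tanh x)\<^sup>2)" "(LINT x|lborel. 1 - (tanh x)\<^sup>2) = (2::real)"
    using has_bochner_integral_sech_square by (auto simp: has_bochner_integral_iff)
  note m = gaussian_mean_approx[OF assms g i(1) integrable_sech_square_moment]
  show "V_op tanh q \<le> 1"
    using m(3) one_minus_V_op_tanh[OF assms] by simp
  show "1 - V_op tanh q \<le> sqrt (2 / pi) / sqrt q"
    using m(1) one_minus_V_op_tanh[OF assms] unfolding inverse_sqrt_two_pi_mult i by simp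
qed

lemma V_op_tanh_asymp:
  "\<exists>C. \<forall>q>0. \<bar>V_op tanh q - (1 - sqrt (2 / pi) / sqrt q)\<bar> \<le> C / sqrt q ^ 3"
proof -
  have g: "0 \<le> 1 - (tanh x)\<^sup>2" for x :: real
    using tanh_square_le_1[of x] by simp
  have i: "integrable lborel (\<lambda>x::real. 1 - (tanh x)\<^sup>2)" "(LINT x|lborel. 1 - (tanh x)\<^sup>2) = (2::real)"
    using has_bochner_integral_sech_square by (auto simp: has_bochner_integral_iff)
  \<comment> \<open>The error c * M/(2q) with second moment M and c = sqrt(2/pi)/(2 sqrt q); the two
    halves make up the 4.\<close>
  let ?C = "sqrt (2 / pi) * (LINT x|lborel. x\<^sup>2 * (1 - (tanh x :: real)\<^sup>2)) / 4"
  have "\<bar>V_op tanh q - (1 - sqrt (2 / pi) / sqrt q)\<bar> \<le> ?C / sqrt q ^ 3" if q: "q > 0" for q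
  proof -
    note m = gaussian_mean_approx[OF q g i(1) integrable_sech_square_moment]
    have "sqrt q ^ 3 = sqrt q * q" using q by (simp add: power3_eq_cube)
    then show ?thesis
      using m(1,2) one_minus_V_op_tanh[OF q] unfolding inverse_sqrt_two_pi_mult i
      by (simp add: mult.commute)
  qed
  then show ?thesis by blast
qed

lemma V_op_deriv_tanh:
  "V_op (deriv tanh) q = (LINT z | lborel. std_normal_density z * (1 - (tanh (sqrt q * z))\<^sup>2)\<^sup>2)"
proof -
  have d: "deriv tanh x = 1 - (tanh x)\<^sup>2" for x :: real
    by (rule DERIV_imp_deriv) (auto intro!: derivative_eq_intros)
  show ?thesis
    unfolding V_op_def d
    by (rule integral_centered_normal) (auto intro!: borel_measurable_continuous_onI continuous_intros)
qed

lemma V_op_nonneg: "0 \<le> V_op f q"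
  unfolding V_op_def by (rule Bochner_Integration.integral_nonneg) simp

lemma V_op_deriv_tanh_asymp:
  "\<exists>C. \<forall>q>0. \<bar>V_op (deriv tanh) q - 2 / 3 * sqrt (2 / pi) / sqrt q\<bar> \<le> C / sqrt q ^ 3"
proof -
  have i: "integrable lborel (\<lambda>x::real. (1 - (tanh x)\<^sup>2)\<^sup>2)"
    "(LINT x|lborel. (1 - (tanh x)\<^sup>2)\<^sup>2) = (4 / 3 :: real)"
    using has_bochner_integral_sech_power4 by (auto simp: has_bochner_integral_iff)
  have i2: "integrable lborel (\<lambda>x::real. x\<^sup>2 * (1 - (tanh x)\<^sup>2)\<^sup>2)"
  proof (rule Bochner_Integration.integrable_bound[OF integrable_sech_square_moment])
    show "AE x in lborel. norm (x\<^sup>2 * (1 - (tanh x)\<^sup>2)\<^sup>2) \<le> norm (x\<^sup>2 * (1 - (tanh x :: real)\<^sup>2))"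
    proof (intro always_eventually allI)
      fix x :: real
      have "0 \<le> 1 - (tanh x)\<^sup>2"
        using tanh_square_le_1[of x] by simp
      moreover from this have "(1 - (tanh x)\<^sup>2)\<^sup>2 \<le> 1 - (tanh x)\<^sup>2"
        unfolding power2_eq_square[of "1 - (tanh x)\<^sup>2"] by (intro mult_left_le) auto
      ultimately show "norm (x\<^sup>2 * (1 - (tanh x)\<^sup>2)\<^sup>2) \<le> norm (x\<^sup>2 * (1 - (tanh x)\<^sup>2))"
        by (simp add: abs_mult mult_left_mono)
    qed
  qed (auto intro!: borel_measurable_continuous_onI continuous_intros)
  let ?C = "sqrt (2 / pi) * (LINT x|lborel. x\<^sup>2 * (1 - (tanh x :: real)\<^sup>2)\<^sup>2) / 4"
  have "\<bar>V_op (deriv tanh) q - 2 / 3 * sqrt (2 / pi) / sqrt q\<bar> \<le> ?C / sqrt q ^ 3" if q: "q > 0" for q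
  proof -
    note m = gaussian_mean_approx[OF q _ i(1) i2]
    have "sqrt q ^ 3 = sqrt q * q" using q by (simp add: power3_eq_cube)
    then show ?thesis
      using m(1,2) unfolding inverse_sqrt_two_pi_mult i V_op_deriv_tanh
      by (simp add: mult.commute)
  qed
  then show ?thesis by blast
qed

section \<open>Monotonicity and positivity of V tanh\<close>

lemma V_op_tanh_mono:
  assumes "0 < q" "q \<le> r"
  shows "V_op tanh q \<le> V_op tanh r"
proof -
  \<comment> \<open>The complements are compared, since their integrability is at hand; pointwise
    the claim is that |tanh| increases with the modulus of its argument.\<close>
  have "1 - V_op tanh r \<le> 1 - V_op tanh q"
    unfolding one_minus_V_op_tanh[OF assms(1)] one_minus_V_op_tanh[OF less_le_trans[OF assms]]
  proof (intro integral_mono integrable_gaussian_sech_square)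
    fix z :: real
    have "\<bar>tanh (sqrt q * z)\<bar> \<le> \<bar>tanh (sqrt r * z)\<bar>"
      unfolding tanh_real_abs[symmetric] using assms by (simp add: abs_mult mult_right_mono)
    then have "(tanh (sqrt q * z))\<^sup>2 \<le> (tanh (sqrt r * z))\<^sup>2"
      by (simp add: abs_le_square_iff)
    then show "std_normal_density z * (1 - (tanh (sqrt r * z))\<^sup>2)
        \<le> std_normal_density z * (1 - (tanh (sqrt q * z))\<^sup>2)"
      by (intro mult_left_mono) (simp_all add: std_normal_density_def)
  qed (use assms in auto)
  then show ?thesis by simp
qed

text \<open>A vanishing average would force tanh(sqrt q * z) = 0 almost everywhere, but this happens
  only on the null set {0}.\<close>

lemma V_op_tanh_pos:
  assumes "q > 0"
  shows "V_op tanh q > 0"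
proof -
  let ?f = "\<lambda>z::real. std_normal_density z * (tanh (sqrt q * z))\<^sup>2"
  have V: "V_op tanh q = integral\<^sup>L lborel ?f"
    unfolding V_op_def by (rule integral_centered_normal)
      (auto intro!: borel_measurable_continuous_onI continuous_intros)
  have int: "integrable lborel ?f"
  proof (rule Bochner_Integration.integrable_bound)
    show "integrable lborel std_normal_density" by simp
    show "AE z in lborel. norm (?f z) \<le> norm (std_normal_density z)"
      by (intro always_eventually allI)
        (auto simp: abs_mult tanh_square_le_1 intro!: mult_left_le)
    show "?f \<in> borel_measurable lborel"
      by (intro borel_measurable_times) (auto intro!: borel_measurable_continuous_onI continuous_intros)
  qed
  have "V_op tanh q \<noteq> 0"
  proof
    assume "V_op tanh q = 0"
    then have "AE z in lborel. ?f z = 0"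
      using int by (subst (asm) V, subst (asm) integral_nonneg_eq_0_iff_AE) (auto simp: std_normal_density_def)
    then have "AE z in lborel. z = (0::real)"
    proof eventually_elim
      case (elim z)
      then show ?case using assms by (simp add: std_normal_density_def)
    qed
    moreover have "AE z in lborel. z \<noteq> (0::real)" by (rule AE_lborel_singleton)
    ultimately have "AE z in (lborel :: real measure). False"
      by eventually_elim simp
    then show False by (simp add: eventually_False ae_filter_eq_bot_iff)
  qed
  with V_op_nonneg[of tanh q] show ?thesis by simp
qed

subsection \<open>The potential\<close>

text \<open>The remainder vanishes at 0 and has derivative y^2/(1+y), which lies between 0 and 3
  y^2; integrating both bounds gives the claim.\<close>

lemma ln_one_plus_quadratic_bound:
  fixes x :: real
  assumes "x \<ge> 0"
  shows "\<bar>ln (1 + x) - x + x\<^sup>2 / 2\<bar> \<le> x ^ 3"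
proof -
  let ?f = "\<lambda>x::real. ln (1 + x) - x + x\<^sup>2 / 2"
  have "?f 0 \<le> ?f x"
  proof (rule DERIV_nonneg_imp_nondecreasing[OF assms])
    fix y :: real assume "0 \<le> y"
    moreover have "0 \<le> 1 / (1 + y) - 1 + y"
      using \<open>0 \<le> y\<close> by (simp add: field_simps)
    ultimately show "\<exists>d. (?f has_real_derivative d) (at y) \<and> 0 \<le> d"
      by (intro exI[of _ "1 / (1 + y) - 1 + y"]) (auto intro!: derivative_eq_intros)
  qed
  moreover have "0 ^ 3 - ?f 0 \<le> x ^ 3 - ?f x"
  proof (rule DERIV_nonneg_imp_nondecreasing[OF assms])
    fix y :: real assume "0 \<le> y"
    moreover have "0 \<le> 3 * y\<^sup>2 - (1 / (1 + y) - 1 + y)"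
      using \<open>0 \<le> y\<close> by (simp add: field_simps power2_eq_square)
    ultimately show "\<exists>d. ((\<lambda>x. x ^ 3 - ?f x) has_real_derivative d) (at y) \<and> 0 \<le> d"
      by (intro exI[of _ "3 * y\<^sup>2 - (1 / (1 + y) - 1 + y)"]) (auto intro!: derivative_eq_intros)
  qed
  ultimately show ?thesis by simp
qed

text \<open>With s, t the two roots, d = (t - s)(t + s), so the error equals -(t - s)^2/(2s)
  exactly, and t - s = d/(t + s) <= d/s.\<close>

lemma sqrt_add_bound:
  fixes q d :: real
  assumes "q > 0" "d \<ge> 0"
  shows "\<bar>sqrt (q + d) - sqrt q - d / (2 * sqrt q)\<bar> \<le> d\<^sup>2 / sqrt q ^ 3"
proof -
  define s t where "s = sqrt q" and "t = sqrt (q + d)"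
  have s: "0 < s" "s \<le> t" and d: "d = (t - s) * (t + s)"
    using assms by (auto simp: s_def t_def algebra_simps power2_eq_square[symmetric])
  have e: "t - s - d / (2 * s) = - ((t - s)\<^sup>2 / (2 * s))"
    using s unfolding d by (simp add: field_simps power2_eq_square)
  have "(t - s)\<^sup>2 / (2 * s) \<le> d\<^sup>2 / s ^ 3"
  proof -
    have "s\<^sup>2 \<le> 2 * (t + s)\<^sup>2"
      using s power_mono[of s "t + s" 2] zero_le_power2[of "t + s"] by linarith
    then have "(t - s)\<^sup>2 * s\<^sup>2 \<le> (t - s)\<^sup>2 * (2 * (t + s)\<^sup>2)"
      by (rule mult_left_mono) simp
    then have "(t - s)\<^sup>2 * s\<^sup>2 \<le> 2 * d\<^sup>2"
      unfolding d by (simp add: power_mult_distrib mult_ac)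
    then have "(t - s)\<^sup>2 * s\<^sup>2 / (2 * s ^ 3) \<le> 2 * d\<^sup>2 / (2 * s ^ 3)"
      using s by (intro divide_right_mono) auto
    then show ?thesis
      using s by (simp add: power3_eq_cube power2_eq_square)
  qed
  moreover have "0 \<le> (t - s)\<^sup>2 / (2 * s)"
    using s by simp
  ultimately show ?thesis
    using e by (simp add: s_def t_def)
qed

lemma ln_add_bound:
  fixes q d :: real
  assumes "q > 0" "d \<ge> 0"
  shows "\<bar>ln (q + d) - ln q - d / q\<bar> \<le> d\<^sup>2 / q\<^sup>2"
proof -
  have "ln (1 + d / q) - d / q \<le> 0"
    using assms ln_add_one_self_le_self[of "d / q"] by simp
  \<comment> \<open>The lower bound applies ln y <= y - 1 at y = 1/(1+x), giving ln(1+x) >= x/(1+x)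
    >= x - x^2.\<close>
  moreover have "d / q - (d / q)\<^sup>2 \<le> ln (1 + d / q)"
  proof -
    define x where "x = d / q"
    have x: "x \<ge> 0" using assms by (simp add: x_def)
    have "ln (1 / (1 + x)) \<le> 1 / (1 + x) - 1"
      using x by (intro ln_le_minus_one) simp
    then have "1 - 1 / (1 + x) \<le> ln (1 + x)"
      using x by (simp add: ln_div)
    moreover have "x - x\<^sup>2 \<le> 1 - 1 / (1 + x)"
      using x by (simp add: field_simps power2_eq_square)
    ultimately show ?thesis unfolding x_def by simp
  qed
  moreover have "ln (q + d) - ln q = ln (1 + d / q)"
  proof -
    have "1 + d / q = (q + d) / q" using assms by (simp add: field_simps)
    then show ?thesis using assms by (simp add: ln_div)
  qed
  ultimately show ?thesis by (simp add: power_divide)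
qed

text \<open>
  The coefficients of \<open>F\<close> are the ones that cancel the terms of order \<open>1 / sqrt q\<close> and \<open>1 / q\<close>.
\<close>
lemma potential_difference_asymp:
  fixes U W :: "real \<Rightarrow> real" and v w K \<kappa> :: real
  assumes pos: "v > 0" "w > 0" "K > 0"
    and U: "(\<lambda>q. U q - (1 - \<kappa> / sqrt q)) \<in> O(\<lambda>q. 1 / sqrt q ^ 3)"
    and W: "(\<lambda>q. W q - 2 / 3 * \<kappa> / sqrt q) \<in> O(\<lambda>q. 1 / sqrt q ^ 3)"
    and W0: "\<And>q. 0 \<le> W q"
    and D0: "\<And>q. 0 \<le> w * (v * U q + (K - v))"
  defines "\<alpha> \<equiv> 2 / 3 * \<kappa> * v * w"
  defines "F \<equiv> \<lambda>q. 2 * \<alpha> / (w * K) * sqrt q + (\<alpha> * v * \<kappa> / K - \<alpha>\<^sup>2 / 2) / (w * K) * ln q"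
  shows "(\<lambda>q. ln (1 + v * w * W q) - (F (q + w * (v * U q + (K - v))) - F q)) \<in> O(\<lambda>q. 1 / sqrt q ^ 3)"
proof -
  \<comment> \<open>\<open>T\<close> is the expansion parameter, \<open>D\<close> the growth of the
    length over one layer, and \<open>E\<close> what remains of \<open>D\<close> after its terms of
    order 1 and \<open>T\<close>. \<open>P1\<close>, \<open>P3\<close>, \<open>P4\<close> are Taylor
    remainders of ln(1+x), of the square root and of the logarithm; every error has to be
    O(T^3).\<close>
  define T where "T q = 1 / sqrt q" for q :: real
  define D where "D q = w * (v * U q + (K - v))" for q
  define E where "E q = D q - (w * K - w * v * \<kappa> * T q)" for q
  define x where "x q = v * w * W q" for q
  define a b where "a = 2 * \<alpha> / (w * K)" and "b = (\<alpha> * v * \<kappa> / K - \<alpha>\<^sup>2 / 2) / (w * K)"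
  define P1 where "P1 q = ln (1 + x q) - x q + (x q)\<^sup>2 / 2" for q
  define P3 where "P3 q = sqrt (q + D q) - sqrt q - D q * T q / 2" for q
  define P4 where "P4 q = ln (q + D q) - ln q - D q * (T q)\<^sup>2" for q
  have T3: "(\<lambda>q. 1 / sqrt q ^ 3) = (\<lambda>q. T q ^ 3)"
    by (simp add: T_def power_divide)
  have T1: "T \<in> O(\<lambda>_. 1)"
    unfolding T_def by real_asymp
  have Tk: "(\<lambda>q. T q ^ (3 + k)) \<in> O(\<lambda>q. T q ^ 3)" for k
  proof -
    have "(\<lambda>q. T q ^ 3 * T q ^ k) \<in> O(\<lambda>q. T q ^ 3 * 1 ^ k)"
      by (intro landau_o.big.mult landau_o.big_power T1) simp
    then show ?thesis by (simp add: power_add)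
  qed
  have E: "E \<in> O(\<lambda>q. T q ^ 3)"
  proof -
    have "E = (\<lambda>q. (w * v) * (U q - (1 - \<kappa> / sqrt q)))"
      by (simp add: fun_eq_iff E_def D_def T_def algebra_simps)
    then show ?thesis using U by (simp add: T3)
  qed
  have T3_1: "(\<lambda>q. T q ^ 3) \<in> O(\<lambda>_. 1)"
    using landau_o.big_power[OF T1, of 3] by simp
  have D: "D \<in> O(\<lambda>_. 1)"
  proof -
    have "(\<lambda>q. E q + (w * K - w * v * \<kappa> * T q)) \<in> O(\<lambda>_. 1)"
      using landau_o.big_trans[OF E T3_1] T1 by (intro sum_in_bigo) auto
    then show ?thesis by (simp add: E_def)
  qed
  have X: "(\<lambda>q. x q - \<alpha> * T q) \<in> O(\<lambda>q. T q ^ 3)"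
  proof -
    have "(\<lambda>q. x q - \<alpha> * T q) = (\<lambda>q. (v * w) * (W q - 2 / 3 * \<kappa> / sqrt q))"
      by (simp add: fun_eq_iff x_def \<alpha>_def T_def algebra_simps)
    then show ?thesis using W by (simp add: T3)
  qed
  have T31: "(\<lambda>q. T q ^ 3) \<in> O(T)"
  proof -
    have "(\<lambda>q. T q * (T q)\<^sup>2) \<in> O(\<lambda>q. T q * 1\<^sup>2)"
      by (intro landau_o.big.mult landau_o.big_power T1) simp
    then show ?thesis by (simp add: power3_eq_cube power2_eq_square mult.assoc)
  qed
  have x: "x \<in> O(T)"
  proof -
    have "x = (\<lambda>q. (x q - \<alpha> * T q) + \<alpha> * T q)" by simp
    also have "\<dots> \<in> O(T)"
      using landau_o.big_trans[OF X T31] by (rule sum_in_bigo) simp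
    finally show ?thesis .
  qed
  have P1: "P1 \<in> O(\<lambda>q. T q ^ 3)"
  proof -
    have "P1 \<in> O(\<lambda>q. x q ^ 3)"
    proof (rule bigoI[of _ 1], intro always_eventually allI)
      show "norm (P1 q) \<le> 1 * norm (x q ^ 3)" for q
        using ln_one_plus_quadratic_bound[of "x q"] pos W0 by (simp add: P1_def x_def)
    qed
    then show ?thesis
      using landau_o.big_power[OF x, of 3] by (rule landau_o.big_trans)
  qed
  have P2: "(\<lambda>q. (x q)\<^sup>2 - \<alpha>\<^sup>2 * (T q)\<^sup>2) \<in> O(\<lambda>q. T q ^ 3)"
  proof -
    have "(\<lambda>q. (x q - \<alpha> * T q) * (x q + \<alpha> * T q)) \<in> O(\<lambda>q. T q ^ 3 * T q)"
      using x by (intro landau_o.big.mult[OF X] sum_in_bigo) auto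
    moreover have "(\<lambda>q. T q ^ 3 * T q) \<in> O(\<lambda>q. T q ^ 3)"
      using Tk[of 1] by (simp add: power_Suc2 mult_ac eval_nat_numeral)
    ultimately have "(\<lambda>q. (x q - \<alpha> * T q) * (x q + \<alpha> * T q)) \<in> O(\<lambda>q. T q ^ 3)"
      by (rule landau_o.big_trans)
    then show ?thesis by (simp add: algebra_simps power2_eq_square)
  qed
  have D2: "(\<lambda>q. (D q)\<^sup>2 * T q ^ (3 + k)) \<in> O(\<lambda>q. T q ^ 3)" for k
    using landau_o.big.mult[OF landau_o.big_power[OF D, of 2] Tk[of k]] by simp
  have P3: "P3 \<in> O(\<lambda>q. T q ^ 3)"
  proof -
    have "P3 \<in> O(\<lambda>q. (D q)\<^sup>2 * T q ^ (3 + 0))"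
    proof (rule bigoI[of _ 1], rule eventually_mono[OF eventually_gt_at_top[of 0]])
      show "norm (P3 q) \<le> 1 * norm ((D q)\<^sup>2 * T q ^ (3 + 0))" if "q > 0" for q
        using sqrt_add_bound[of q "D q"] D0[of q] that
        by (simp add: P3_def T_def D_def power_divide abs_mult)
    qed
    then show ?thesis using D2[of 0] by (rule landau_o.big_trans)
  qed
  have P4: "P4 \<in> O(\<lambda>q. T q ^ 3)"
  proof -
    have "P4 \<in> O(\<lambda>q. (D q)\<^sup>2 * T q ^ (3 + 1))"
    proof (rule bigoI[of _ 1], rule eventually_mono[OF eventually_gt_at_top[of 0]])
      fix q :: real assume q: "q > 0"
      then have "(T q)\<^sup>2 = 1 / q" "T q ^ (3 + 1) = 1 / q\<^sup>2"
        using power_mult[of "sqrt q" 2 2] by (auto simp: T_def power_divide)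
      then show "norm (P4 q) \<le> 1 * norm ((D q)\<^sup>2 * T q ^ (3 + 1))"
        using ln_add_bound[of q "D q"] D0[of q] q by (simp add: P4_def D_def)
    qed
    then show ?thesis using D2[of 1] by (rule landau_o.big_trans)
  qed
  have ET: "(\<lambda>q. E q * T q) \<in> O(\<lambda>q. T q ^ 3)" "(\<lambda>q. E q * (T q)\<^sup>2) \<in> O(\<lambda>q. T q ^ 3)"
    using landau_o.big.mult[OF E T1] landau_o.big.mult[OF E landau_o.big_power[OF T1, of 2]] by simp_all
  \<comment> \<open>Matching a D T/2 + b D T^2 with \<alpha> T - \<alpha>^2 T^2/2, the first
    equation settles order \<open>T\<close> and the second order T^2. The term with \<kappa> in the
    second is the correction of \<open>D\<close> acting on the square-root part of
    \<open>F\<close>.\<close>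
  have ab: "a * (w * K) = 2 * \<alpha>" "b * (w * K) = a * (w * v * \<kappa>) / 2 - \<alpha>\<^sup>2 / 2"
    using pos by (auto simp: a_def b_def field_simps)
  \<comment> \<open>The bookkeeping is a linear identity; stating it over plain variables keeps the
    arithmetic away from the compound terms.\<close>
  have collect: "g - Fd = P + (x - p) - (x2 - u) / 2 - A3 - A4 - e - h + c"
    if "A3 + A4 = Fd - X - Y" "X = p - s + e" "Y = (s - u / 2) - c + h" "g = P + x - x2 / 2"
    for g Fd P x p x2 u A3 A4 e h c X Y s :: real
    using that by (simp add: field_simps)
  have "ln (1 + v * w * W q) - (F (q + D q) - F q)
      = P1 q + (x q - \<alpha> * T q) - ((x q)\<^sup>2 - \<alpha>\<^sup>2 * (T q)\<^sup>2) / 2 - a * P3 q - b * P4 q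
        - a / 2 * (E q * T q) - b * (E q * (T q)\<^sup>2) + b * (w * v * \<kappa>) * T q ^ 3" for q
  proof (rule collect)
    have "F = (\<lambda>q. a * sqrt q + b * ln q)"
      by (simp add: F_def a_def b_def)
    then show "a * P3 q + b * P4 q = F (q + D q) - F q - a * (D q * T q) / 2 - b * (D q * (T q)\<^sup>2)"
      by (simp add: P3_def P4_def algebra_simps)
    have "a * (D q * T q) / 2 = (a * (w * K)) / 2 * T q - a * (w * v * \<kappa>) / 2 * (T q)\<^sup>2 + a / 2 * (E q * T q)"
      by (simp add: E_def algebra_simps power2_eq_square)
    then show "a * (D q * T q) / 2 = \<alpha> * T q - a * (w * v * \<kappa>) / 2 * (T q)\<^sup>2 + a / 2 * (E q * T q)"
      by (simp add: ab)
    have "b * (D q * (T q)\<^sup>2) = (b * (w * K)) * (T q)\<^sup>2 - b * (w * v * \<kappa>) * T q ^ 3 + b * (E q * (T q)\<^sup>2)"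
      by (simp add: E_def algebra_simps power2_eq_square power3_eq_cube)
    then show "b * (D q * (T q)\<^sup>2) = (a * (w * v * \<kappa>) / 2 * (T q)\<^sup>2 - (\<alpha>\<^sup>2 * (T q)\<^sup>2) / 2)
        - b * (w * v * \<kappa>) * T q ^ 3 + b * (E q * (T q)\<^sup>2)"
      by (simp add: ab left_diff_distrib)
    show "ln (1 + v * w * W q) = P1 q + x q - (x q)\<^sup>2 / 2"
      by (simp add: P1_def x_def)
  qed
  \<comment> \<open>These differences are small only as wholes. Naming them stops
    \<open>sum_in_bigo\<close> from splitting them into summands that are not O(T^3).\<close>
  moreover define X1 X2 where "X1 q = x q - \<alpha> * T q" and "X2 q = (x q)\<^sup>2 - \<alpha>\<^sup>2 * (T q)\<^sup>2" for q
  moreover have "(\<lambda>q. P1 q + X1 q - X2 q / 2 - a * P3 q - b * P4 q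
        - a / 2 * (E q * T q) - b * (E q * (T q)\<^sup>2) + b * (w * v * \<kappa>) * T q ^ 3) \<in> O(\<lambda>q. T q ^ 3)"
  proof -
    have "X1 \<in> O(\<lambda>q. T q ^ 3)" "X2 \<in> O(\<lambda>q. T q ^ 3)"
      using X P2 by (simp_all add: X1_def[abs_def] X2_def[abs_def])
    then show ?thesis
      using P1 P3 P4 ET by (intro sum_in_bigo) auto
  qed
  ultimately show ?thesis
    by (simp add: T3 D_def)
qed

subsection \<open>Growth of the length sequence and the gradient ratio\<close>

text \<open>The sequence never drops below \<open>r 1\<close>, so by monotonicity each increment is
  at least \<open>D (r 1)\<close>. Taking the minimum with \<open>r 1\<close> covers n = 1.\<close>

lemma linear_growth:
  fixes r :: "nat \<Rightarrow> real"
  assumes step: "\<And>n. r (Suc n) = r n + D (r n)" and r1: "r 1 > 0"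
    and D_pos: "\<And>q. q > 0 \<Longrightarrow> D q > 0"
    and D_mono: "\<And>p q. 0 < p \<Longrightarrow> p \<le> q \<Longrightarrow> D p \<le> D q"
  shows "\<exists>c>0. \<forall>n\<ge>1. c * real n \<le> r n"
proof (intro exI[of _ "min (r 1) (D (r 1))"] conjI allI impI)
  let ?c = "min (r 1) (D (r 1))"
  show "?c > 0" using r1 D_pos by simp
  have "?c * real n \<le> r n \<and> r 1 \<le> r n" if "n \<ge> 1" for n
    using that
  proof (induction n rule: dec_induct)
    case (step n)
    then have "D (r 1) \<le> D (r n)" using r1 by (intro D_mono) auto
    moreover have "D (r 1) > 0" using r1 D_pos by simp
    ultimately show ?case using step assms(1)[of n] by (auto simp: algebra_simps)
  qed simp
  then show "?c * real n \<le> r n" if "n \<ge> 1" for n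
    using that by blast
qed

text \<open>The deviations 1/sqrt n are dominated by increments of sqrt n, so their sum telescopes
  to order sqrt n.\<close>

lemma linear_asymp_sqrt_error:
  fixes r :: "nat \<Rightarrow> real"
  assumes "\<And>n. n \<ge> 1 \<Longrightarrow> \<bar>r (Suc n) - r n - k\<bar> \<le> M / sqrt n"
  shows "\<exists>C. \<forall>n\<ge>1. \<bar>r n - k * real n\<bar> \<le> C * sqrt n"
proof -
  let ?b = "\<bar>r 1 - k\<bar>"
  have M: "M \<ge> 0" using assms[of 1] by simp
  \<comment> \<open>The 3 comes from sqrt(n+1) <= 2 sqrt n for n >= 1, added to one more sqrt
    n.\<close>
  have root: "1 / sqrt n \<le> 3 * (sqrt (Suc n) - sqrt n)" if "n \<ge> 1" for n
  proof -
    have n: "0 < sqrt n" using that by simp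
    have "sqrt (Suc n) \<le> sqrt (4 * n)" using that by (intro real_sqrt_le_mono) simp
    then have le: "sqrt (Suc n) + sqrt n \<le> 3 * sqrt n" by (simp add: real_sqrt_mult)
    have "(sqrt (Suc n) - sqrt n) * (sqrt (Suc n) + sqrt n) = 1"
      by (simp add: algebra_simps power2_eq_square[symmetric])
    moreover have "(sqrt (Suc n) - sqrt n) * (sqrt (Suc n) + sqrt n)
        \<le> (sqrt (Suc n) - sqrt n) * (3 * sqrt n)"
      using le by (intro mult_left_mono) auto
    ultimately show ?thesis using n by (simp add: pos_divide_le_eq mult_ac)
  qed
  have bound: "\<bar>r n - k * real n\<bar> \<le> ?b + 3 * M * sqrt n" if "n \<ge> 1" for n
    using that
  proof (induction n rule: dec_induct)
    case base
    then show ?case using M by simp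
  next
    case (step n)
    have "M * (1 / sqrt n) \<le> M * (3 * (sqrt (Suc n) - sqrt n))"
      using root[OF step(1)] M by (rule mult_left_mono)
    then have "M / sqrt n \<le> 3 * M * sqrt (Suc n) - 3 * M * sqrt n"
      by (simp add: algebra_simps)
    moreover have "r (Suc n) - k * real (Suc n) = (r (Suc n) - r n - k) + (r n - k * real n)"
      by (simp add: algebra_simps)
    ultimately show ?case
      using assms[OF step(1)] step(3) by linarith
  qed
  have "\<bar>r n - k * real n\<bar> \<le> (?b + 3 * M) * sqrt n" if "n \<ge> 1" for n
  proof -
    have "?b * 1 \<le> ?b * sqrt n" using that by (intro mult_left_mono) auto
    then show ?thesis using bound[OF that] by (simp add: algebra_simps)
  qed
  then show ?thesis by blast
qed

text \<open>In a difference of square roots the error C sqrt n is divided by a sum of roots that is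
  at least sqrt k * sqrt n, so only a constant survives.\<close>

lemma sqrt_linear_asymp:
  fixes r :: "nat \<Rightarrow> real"
  assumes "k > 0" "\<And>n. n \<ge> 1 \<Longrightarrow> r n > 0"
    and "\<And>n. n \<ge> 1 \<Longrightarrow> \<bar>r n - k * real n\<bar> \<le> C * sqrt n"
  shows "n \<ge> 1 \<Longrightarrow> \<bar>sqrt (r n) - sqrt k * sqrt n\<bar> \<le> C / sqrt k"
proof -
  assume n: "n \<ge> 1"
  define s t where "s = sqrt (r n)" and "t = sqrt k * sqrt n"
  have pos: "0 < s" "0 < t" using assms n by (auto simp: s_def t_def)
  have "(s - t) * (s + t) = r n - k * real n"
    using assms(1) assms(2)[OF n] by (simp add: s_def t_def algebra_simps power2_eq_square[symmetric])
  then have "\<bar>r n - k * real n\<bar> = \<bar>s - t\<bar> * \<bar>s + t\<bar>"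
    by (metis abs_mult)
  then have "\<bar>s - t\<bar> * (s + t) = \<bar>r n - k * real n\<bar>"
    using pos by simp
  moreover have "\<bar>s - t\<bar> * t \<le> \<bar>s - t\<bar> * (s + t)"
    using pos by (intro mult_left_mono) auto
  ultimately have "\<bar>s - t\<bar> * t \<le> C * sqrt n"
    using assms(3)[OF n] by linarith
  then have "(\<bar>s - t\<bar> * sqrt k) * sqrt n \<le> C * sqrt n"
    by (simp add: t_def mult_ac)
  then have "\<bar>s - t\<bar> * sqrt k \<le> C"
    using n by (simp add: mult_le_cancel_right)
  then show "\<bar>sqrt (r n) - sqrt k * sqrt n\<bar> \<le> C / sqrt k"
    using assms(1) by (simp add: s_def t_def pos_le_divide_eq)
qed

text \<open>The ratio r n/n stays between \<open>c\<close> and \<open>k + C\<close>. The separate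
  constant \<open>c\<close> serves below because k n - C sqrt n may be negative for small n.\<close>

lemma ln_linear_bounded:
  fixes r :: "nat \<Rightarrow> real"
  assumes "c > 0" "\<And>n. n \<ge> 1 \<Longrightarrow> c * real n \<le> r n"
    and "k > 0" "\<And>n. n \<ge> 1 \<Longrightarrow> \<bar>r n - k * real n\<bar> \<le> C * sqrt n"
  shows "n \<ge> 1 \<Longrightarrow> \<bar>ln (r n) - ln n\<bar> \<le> \<bar>ln c\<bar> + \<bar>ln (k + C)\<bar>"
proof -
  assume n: "n \<ge> 1"
  have C: "C \<ge> 0" using assms(4)[of 1] by simp
  have "C * sqrt n \<le> C * n"
  proof (rule mult_left_mono[OF _ C])
    show "sqrt n \<le> real n" using n by (intro real_le_lsqrt) (auto simp: power2_eq_square)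
  qed
  then have le: "r n \<le> (k + C) * n"
    using assms(4)[OF n] by (simp add: algebra_simps)
  have pos: "0 < c * n" "0 < r n"
    using assms(1) assms(2)[OF n] n by (auto intro: less_le_trans[of _ "c * n"])
  have "ln (c * n) \<le> ln (r n)"
    using assms(2)[OF n] pos by simp
  moreover have "ln (r n) \<le> ln ((k + C) * n)"
    using le pos by simp
  ultimately show ?thesis
    using assms(1,3) C n by (simp add: ln_mult)
qed

text \<open>The full series of absolute values bounds all interval sums at once, so the bound is
  uniform in both ends.\<close>

lemma summable_interval_sums_bounded:
  fixes f :: "nat \<Rightarrow> real"
  assumes "f \<in> O(\<lambda>n. real n powr s)" "s < - 1"
  shows "\<exists>C. \<forall>m l. \<bar>sum f {m..<l}\<bar> \<le> C"
proof -
  have "summable (\<lambda>n. norm (real n powr s))"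
    using assms(2) by (simp add: summable_real_powr_iff)
  moreover have "(\<lambda>n. norm (f n)) \<in> O(\<lambda>n. real n powr s)"
    using assms(1) by (simp add: landau_o.big.abs_in_iff)
  ultimately have sf: "summable (\<lambda>n. norm (f n))"
    by (rule summable_comparison_test_bigo)
  have "\<bar>sum f {m..<l}\<bar> \<le> (\<Sum>n. norm (f n))" for m l
  proof -
    have "\<bar>sum f {m..<l}\<bar> \<le> (\<Sum>n=m..<l. norm (f n))"
      unfolding real_norm_def by (rule sum_abs)
    also have "\<dots> \<le> (\<Sum>n. norm (f n))"
      by (rule sum_le_suminf[OF sf]) simp_all
    finally show ?thesis .
  qed
  then show ?thesis by blast
qed

section \<open>The length and gradient recurrences of the network\<close>

lemma frn_q_Suc_Suc:
  "frn_q \<phi> \<sigma>v \<sigma>a \<sigma>w \<sigma>b p0 (Suc (Suc n)) =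
     frn_q \<phi> \<sigma>v \<sigma>a \<sigma>w \<sigma>b p0 (Suc n)
     + \<sigma>w\<^sup>2 * (\<sigma>v\<^sup>2 * V_op \<phi> (frn_q \<phi> \<sigma>v \<sigma>a \<sigma>w \<sigma>b p0 (Suc n)) + \<sigma>a\<^sup>2)"
  by (simp add: frn_q_def algebra_simps)

text \<open>Every backward factor is at least 1, so positivity spreads from layer \<open>L\<close>
  down to all earlier layers; the quotient is then a product of positive factors, and its logarithm
  is a sum.\<close>

lemma ln_frn_gradient_ratio:
  assumes "frn_gradient \<phi> \<sigma>v \<sigma>a \<sigma>w \<sigma>b p0 L chi" "chi L > 0" "m \<le> l" "l \<le> L"
  shows "ln (chi m / chi l) =
    (\<Sum>n=m..<l. ln (1 + \<sigma>v\<^sup>2 * \<sigma>w\<^sup>2 * V_op (deriv \<phi>) (frn_q \<phi> \<sigma>v \<sigma>a \<sigma>w \<sigma>b p0 (Suc n))))"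
proof -
  define g where "g n = 1 + \<sigma>v\<^sup>2 * \<sigma>w\<^sup>2 * V_op (deriv \<phi>) (frn_q \<phi> \<sigma>v \<sigma>a \<sigma>w \<sigma>b p0 (Suc n))" for n
  have g: "g n \<ge> 1" for n by (simp add: g_def V_op_nonneg)
  have rec: "chi n = g n * chi (Suc n)" if "n < L" for n
  proof -
    have "Suc n \<in> {1..L}" using that by simp
    then have "chi (Suc n - 1) = (\<sigma>v\<^sup>2 * \<sigma>w\<^sup>2 * V_op (deriv \<phi>) (frn_q \<phi> \<sigma>v \<sigma>a \<sigma>w \<sigma>b p0 (Suc n)) + 1) * chi (Suc n)"
      using assms(1) unfolding frn_gradient_def by (rule bspec[rotated])
    then show ?thesis by (simp only: g_def add.commute diff_Suc_1)
  qed
  have pos: "chi n > 0" if "n \<le> L" for n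
    using that
  proof (induction n rule: inc_induct)
    case (step n)
    have "0 < g n * chi (Suc n)"
      using g[of n] step(3) by (intro mult_pos_pos) auto
    then show ?case by (simp only: rec[OF step(2)])
  qed (rule assms)
  have "k \<le> L \<longrightarrow> ln (chi m / chi k) = (\<Sum>n=m..<k. ln (g n))" if "m \<le> k" for k
    using that
  proof (induction k rule: dec_induct)
    case base
    then show ?case using pos[of m] by simp
  next
    case (step k)
    show ?case
    proof
      assume k: "Suc k \<le> L"
      have "chi m / chi (Suc k) = (chi m / chi k) * g k"
        unfolding rec[OF Suc_le_lessD[OF k]] using pos[OF k] g[of k] by simp
      moreover have "0 < chi m / chi k" "0 < g k"
        using pos[of m] pos[of k] g[of k] step k by auto
      ultimately have "ln (chi m / chi (Suc k)) = ln (chi m / chi k) + ln (g k)"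
        by (simp only: ln_mult_pos)
      then show "ln (chi m / chi (Suc k)) = (\<Sum>n=m..<Suc k. ln (g n))"
        using step k by simp
    qed
  qed
  then show ?thesis using assms(3,4) by (simp add: g_def)
qed

text \<open>Neither \<open>chi\<close> nor \<open>L\<close> occurs here, so the constant is
  automatically uniform in the depth and in the gradient at the last layer.\<close>

lemma tanh_gradient_asymp:
  fixes \<sigma>v \<sigma>a \<sigma>w \<sigma>b p0 :: real
  assumes nonneg: "\<sigma>a \<ge> 0" "\<sigma>b \<ge> 0" "p0 \<ge> 0"
    and \<sigma>v: "\<sigma>v > 0" and \<sigma>w: "\<sigma>w > 0" and nontrivial: "p0 > 0 \<or> \<sigma>a > 0 \<or> \<sigma>b > 0"
  defines "A \<equiv> 4 / 3 * sqrt (2 / pi) * (\<sigma>v\<^sup>2 * \<sigma>w / sqrt (\<sigma>v\<^sup>2 + \<sigma>a\<^sup>2))"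
    and "B \<equiv> 4 / (9 * pi) * (\<sigma>v ^ 4 / (\<sigma>v\<^sup>2 + \<sigma>a\<^sup>2)) * (3 / (\<sigma>v\<^sup>2 + \<sigma>a\<^sup>2) - \<sigma>w\<^sup>2)"
  shows "\<exists>C. \<forall>l m. 1 \<le> m \<and> m \<le> l \<longrightarrow>
    \<bar>(\<Sum>n=m..<l. ln (1 + \<sigma>v\<^sup>2 * \<sigma>w\<^sup>2 * V_op (deriv tanh) (frn_q tanh \<sigma>v \<sigma>a \<sigma>w \<sigma>b p0 (Suc n))))
      - (A * (sqrt (real l) - sqrt (real m)) + B * (ln (real l) - ln (real m)))\<bar> \<le> C"
proof -
  define v w a K \<kappa> where "v = \<sigma>v\<^sup>2" and "w = \<sigma>w\<^sup>2" and "a = \<sigma>a\<^sup>2" and "K = v + a" and "\<kappa> = sqrt (2 / pi)"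
  \<comment> \<open>The shift makes \<open>r n\<close> the length entering the factor between layers
    \<open>n\<close> and \<open>Suc n\<close>; the offset by one layer disappears in the O(sqrt n)
    error of its growth.\<close>
  define r where "r n = frn_q tanh \<sigma>v \<sigma>a \<sigma>w \<sigma>b p0 (Suc n)" for n
  define D where "D q = w * (v * V_op tanh q + (K - v))" for q
  define G where "G q = ln (1 + v * w * V_op (deriv tanh) q)" for q
  define \<alpha> \<beta> where "\<alpha> = 2 / 3 * \<kappa> * v * w" and "\<beta> = (\<alpha> * v * \<kappa> / K - \<alpha>\<^sup>2 / 2) / (w * K)"
  define F where "F q = 2 * \<alpha> / (w * K) * sqrt q + \<beta> * ln q" for q
  have pos: "v > 0" "w > 0" "a \<ge> 0" "K > 0" "w * K > 0"
    using \<sigma>v \<sigma>w by (auto simp: v_def w_def a_def K_def intro!: add_pos_nonneg mult_pos_pos)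
  have D0: "D q \<ge> 0" for q
    using pos V_op_nonneg by (simp add: D_def K_def)
  have step: "r (Suc n) = r n + D (r n)" for n
    unfolding r_def frn_q_Suc_Suc by (simp add: D_def K_def v_def w_def a_def)
  \<comment> \<open>Everything starts at index 1 because \<open>r 0\<close> vanishes when
    \<open>p0\<close> and \<open>\<sigma>b\<close> do; in that case \<open>\<sigma>a\<close> is
    positive and lifts the next length above 0.\<close>
  have r1: "r 1 > 0"
  proof -
    have r0: "r 0 = w * p0 + \<sigma>b\<^sup>2"
      by (simp add: r_def frn_q_def w_def)
    show ?thesis
    proof (cases "r 0 > 0")
      case True
      then show ?thesis using step[of 0] D0[of "r 0"] by simp
    next
      case False
      have "0 \<le> w * p0" "0 \<le> \<sigma>b\<^sup>2" using nonneg pos by auto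
      then have "w * p0 = 0" "\<sigma>b\<^sup>2 = 0" using False unfolding r0 by linarith+
      then have "p0 = 0" "\<sigma>b = 0" using pos by auto
      then have "w * a > 0" using nontrivial pos by (simp add: a_def)
      then show ?thesis
        using step[of 0] V_op_nonneg[of tanh "r 0"] pos r0 \<open>p0 = 0\<close> \<open>\<sigma>b = 0\<close>
        by (simp add: D_def K_def distrib_left add_nonneg_pos)
    qed
  qed
  obtain c where c: "c > 0" "\<And>n. n \<ge> 1 \<Longrightarrow> c * real n \<le> r n"
  proof -
    have "\<exists>c>0. \<forall>n\<ge>1. c * real n \<le> r n"
    proof (rule linear_growth[where D = D, OF step r1])
      show "D q > 0" if "q > 0" for q
        using V_op_tanh_pos[OF that] pos by (simp add: D_def K_def add_pos_nonneg)
      show "D p \<le> D q" if "0 < p" "p \<le> q" for p q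
        using V_op_tanh_mono[OF that] pos by (simp add: D_def)
    qed
    then show ?thesis using that by blast
  qed
  have rpos: "r n > 0" if "n \<ge> 1" for n
    using c(1) c(2)[OF that] that by (auto intro: less_le_trans[of _ "c * n"])
  \<comment> \<open>The slope \<open>w * K\<close> is the increment at saturation, where V tanh
    would be 1. The deficit w v (1 - V tanh) is of order 1/sqrt n by the linear lower bound on
    \<open>r\<close>.\<close>
  obtain C where C: "\<And>n. n \<ge> 1 \<Longrightarrow> \<bar>r n - w * K * real n\<bar> \<le> C * sqrt n"
  proof -
    have "\<exists>C. \<forall>n\<ge>1. \<bar>r n - w * K * real n\<bar> \<le> C * sqrt n"
    proof (rule linear_asymp_sqrt_error)
      fix n :: nat assume n: "n \<ge> 1"
      have "r (Suc n) - r n - w * K = - (w * v * (1 - V_op tanh (r n)))"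
        unfolding step by (simp add: D_def algebra_simps)
      then have "\<bar>r (Suc n) - r n - w * K\<bar> = w * v * (1 - V_op tanh (r n))"
        using pos V_op_tanh_bounds(1)[OF rpos[OF n]] by (simp add: abs_mult)
      also have "\<dots> \<le> w * v * (\<kappa> / sqrt (c * n))"
      proof (rule mult_left_mono)
        have "\<kappa> / sqrt (r n) \<le> \<kappa> / sqrt (c * n)"
          using c n rpos[OF n] by (intro divide_left_mono) (auto simp: \<kappa>_def)
        then show "1 - V_op tanh (r n) \<le> \<kappa> / sqrt (c * n)"
          using V_op_tanh_bounds(2)[OF rpos[OF n]] by (simp add: \<kappa>_def)
      qed (use pos in simp)
      finally show "\<bar>r (Suc n) - r n - w * K\<bar> \<le> (w * v * \<kappa> / sqrt c) / sqrt n"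
        by (simp add: real_sqrt_mult)
    qed
    then show ?thesis using that by blast
  qed
  have inf: "filterlim r at_top sequentially"
  proof (rule filterlim_at_top_mono)
    show "filterlim (\<lambda>n. c * real n) at_top sequentially"
      using c(1) by real_asymp
    show "\<forall>\<^sub>F n in sequentially. c * real n \<le> r n"
      using eventually_ge_at_top[of 1] by eventually_elim (rule c(2))
  qed
  have bigo: "f \<in> O(\<lambda>q. 1 / sqrt q ^ 3)" if "\<exists>C. \<forall>q>0. \<bar>f q\<bar> \<le> C / sqrt q ^ 3" for f :: "real \<Rightarrow> real"
  proof -
    from that obtain C where "\<And>q. q > 0 \<Longrightarrow> \<bar>f q\<bar> \<le> C / sqrt q ^ 3" by blast
    then show ?thesis
      by (intro bigoI[of _ C] eventually_mono[OF eventually_gt_at_top[of 0]]) (simp add: power_abs)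
  qed
  \<comment> \<open>\<open>H\<close> is the defect of the potential over one layer. Since
    \<open>r\<close> tends to infinity at least linearly, the expansion in q becomes O(n^(-3/2)) in
    the layer index.\<close>
  define H where "H n = G (r n) - (F (r (Suc n)) - F (r n))" for n
  have "(\<lambda>q. G q - (F (q + D q) - F q)) \<in> O(\<lambda>q. 1 / sqrt q ^ 3)"
    unfolding G_def F_def D_def \<beta>_def \<alpha>_def
  proof (rule potential_difference_asymp[where U = "V_op tanh" and W = "V_op (deriv tanh)"])
    show "(\<lambda>q. V_op tanh q - (1 - \<kappa> / sqrt q)) \<in> O(\<lambda>q. 1 / sqrt q ^ 3)"
      unfolding \<kappa>_def by (rule bigo[OF V_op_tanh_asymp])
    show "(\<lambda>q. V_op (deriv tanh) q - 2 / 3 * \<kappa> / sqrt q) \<in> O(\<lambda>q. 1 / sqrt q ^ 3)"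
      unfolding \<kappa>_def by (rule bigo[OF V_op_deriv_tanh_asymp])
    show "0 \<le> w * (v * V_op tanh q + (K - v))" for q
      using D0[of q] by (simp add: D_def)
  qed (use pos V_op_nonneg in auto)
  from landau_o.big.compose[OF this inf]
  have "H \<in> O(\<lambda>n. 1 / sqrt (r n) ^ 3)"
    by (simp add: H_def[abs_def] step)
  also have "(\<lambda>n. 1 / sqrt (r n) ^ 3) \<in> O(\<lambda>n. real n powr (- (3 / 2)))"
  proof (rule bigoI[of _ "1 / sqrt c ^ 3"], rule eventually_mono[OF eventually_ge_at_top[of 1]])
    fix n :: nat assume n: "1 \<le> n"
    have "real n powr (3 / 2) = sqrt n ^ 3"
    proof -
      have "sqrt n ^ 3 = (n powr (1 / 2)) powr 3"
        using n by (simp add: powr_half_sqrt powr_numeral)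
      then show ?thesis by (simp add: powr_powr)
    qed
    then have "sqrt c ^ 3 * (real n powr (3 / 2)) = sqrt (c * n) ^ 3"
      by (simp add: real_sqrt_mult power_mult_distrib)
    moreover have "1 / sqrt (r n) ^ 3 \<le> 1 / sqrt (c * n) ^ 3"
      using c n rpos[OF n] by (intro divide_left_mono power_mono mult_pos_pos) auto
    ultimately show "norm (1 / sqrt (r n) ^ 3) \<le> 1 / sqrt c ^ 3 * norm (real n powr (- (3 / 2)))"
      using rpos[OF n] by (simp add: powr_minus field_simps)
  qed
  finally obtain CH where CH: "\<And>m l. \<bar>sum H {m..<l}\<bar> \<le> CH"
    using summable_interval_sums_bounded[of H "- (3 / 2)"] by auto
  \<comment> \<open>The square-root coefficient of \<open>F\<close>, rescaled because sqrt(r n)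
    behaves like sqrt(w K) * sqrt n.\<close>
  have A: "A = 2 * \<alpha> / (w * K) * sqrt (w * K)"
  proof -
    have "sqrt w = \<sigma>w" using \<sigma>w by (simp add: w_def)
    then have "2 * \<alpha> / (w * K) * sqrt (w * K) = 4 / 3 * \<kappa> * (v * \<sigma>w * (sqrt K / K))"
      using pos by (simp add: \<alpha>_def real_sqrt_mult)
    also have "sqrt K / K = 1 / sqrt K"
      using pos by (simp add: sqrt_divide_self_eq inverse_eq_divide)
    finally show ?thesis
      unfolding A_def by (simp add: \<kappa>_def K_def v_def a_def)
  qed
  \<comment> \<open>The logarithm needs no rescaling: the slope adds only a constant to ln(r n). The
    factor 1/pi arises from \<kappa>^2 = 2/pi.\<close>
  have B: "B = \<beta>"
  proof -
    have k2: "\<kappa>\<^sup>2 = 2 / pi" by (simp add: \<kappa>_def)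
    have "\<beta> = \<kappa>\<^sup>2 * (2 / 3 * v\<^sup>2 / K\<^sup>2 - 2 / 9 * v\<^sup>2 * w / K)"
      using pos unfolding \<beta>_def \<alpha>_def by (simp add: field_simps power2_eq_square)
    moreover have "B = 4 / (9 * pi) * (v\<^sup>2 / K) * (3 / K - w)"
      unfolding B_def v_def[symmetric] w_def[symmetric] a_def[symmetric] K_def[symmetric]
      by (simp add: v_def flip: power_mult)
    moreover have "4 / (9 * pi) * (v\<^sup>2 / K) * (3 / K - w)
        = 2 / pi * (2 / 3 * v\<^sup>2 / K\<^sup>2 - 2 / 9 * v\<^sup>2 * w / K)"
      using pos by (simp add: field_simps power2_eq_square)
    ultimately show ?thesis
      unfolding k2 by simp
  qed
  define C1 where "C1 = \<bar>2 * \<alpha> / (w * K)\<bar> * (C / sqrt (w * K)) + \<bar>\<beta>\<bar> * (\<bar>ln c\<bar> + \<bar>ln (w * K + C)\<bar>)"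
  have F: "\<bar>F (r n) - (A * sqrt n + B * ln n)\<bar> \<le> C1" if n: "n \<ge> 1" for n
  proof -
    have "F (r n) - (A * sqrt n + B * ln n)
        = 2 * \<alpha> / (w * K) * (sqrt (r n) - sqrt (w * K) * sqrt n) + \<beta> * (ln (r n) - ln n)"
      unfolding A B F_def by (simp add: algebra_simps)
    also have "\<bar>\<dots>\<bar> \<le> \<bar>2 * \<alpha> / (w * K)\<bar> * \<bar>sqrt (r n) - sqrt (w * K) * sqrt n\<bar> + \<bar>\<beta>\<bar> * \<bar>ln (r n) - ln n\<bar>"
      by (rule order_trans[OF abs_triangle_ineq]) (simp only: abs_mult order_refl)
    also have "\<dots> \<le> C1"
      unfolding C1_def using sqrt_linear_asymp[OF pos(5) rpos C n] ln_linear_bounded[OF c pos(5) C n]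
      by (intro add_mono mult_left_mono) auto
    finally show ?thesis .
  qed
  \<comment> \<open>The summed defects cost \<open>CH\<close>; replacing F(r) by its explicit form
    costs \<open>C1\<close> at each of the two ends.\<close>
  have "\<bar>(\<Sum>n=m..<l. G (r n)) - (A * (sqrt l - sqrt m) + B * (ln l - ln m))\<bar> \<le> CH + C1 + C1"
    if "1 \<le> m" "m \<le> l" for l m :: nat
  proof -
    have "(\<Sum>n=m..<l. G (r n)) = sum H {m..<l} + (\<Sum>n=m..<l. F (r (Suc n)) - F (r n))"
      by (simp add: H_def sum.distrib flip: sum.distrib)
    also have "(\<Sum>n=m..<l. F (r (Suc n)) - F (r n)) = F (r l) - F (r m)"
      using that(2) by (rule sum_Suc_diff')
    finally have "(\<Sum>n=m..<l. G (r n)) - (A * (sqrt l - sqrt m) + B * (ln l - ln m))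
        = sum H {m..<l} + (F (r l) - (A * sqrt l + B * ln l)) - (F (r m) - (A * sqrt m + B * ln m))"
      by (simp add: algebra_simps)
    then show ?thesis
      using CH[of m l] F[of l] F[of m] that by linarith
  qed
  then show ?thesis
    unfolding G_def r_def v_def w_def
    by (intro exI[of _ "CH + C1 + C1"] allI impI, elim conjE)
qed

theorem theoremB13:
  fixes \<sigma>v \<sigma>a \<sigma>w \<sigma>b p0 :: real
  assumes "\<sigma>v \<ge> 0" and "\<sigma>a \<ge> 0" and "\<sigma>w \<ge> 0" and "\<sigma>b \<ge> 0" and "p0 \<ge> 0"
  shows "(\<sigma>w = 0 \<longrightarrow>
            (\<forall>L chi. frn_gradient tanh \<sigma>v \<sigma>a \<sigma>w \<sigma>b p0 L chi \<longrightarrow>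
              (\<forall>l\<le>L. \<forall>m\<le>L. chi m = chi l)))
       \<and> (\<sigma>w > 0 \<and> (p0 > 0 \<or> \<sigma>a > 0 \<or> \<sigma>b > 0) \<longrightarrow>
            (let A = 4 / 3 * sqrt (2 / pi) * (\<sigma>v\<^sup>2 * \<sigma>w / sqrt (\<sigma>v\<^sup>2 + \<sigma>a\<^sup>2));
                 B = 4 / (9 * pi) * (\<sigma>v ^ 4 / (\<sigma>v\<^sup>2 + \<sigma>a\<^sup>2)) * (3 / (\<sigma>v\<^sup>2 + \<sigma>a\<^sup>2) - \<sigma>w\<^sup>2)
             in \<exists>C. \<forall>L chi. frn_gradient tanh \<sigma>v \<sigma>a \<sigma>w \<sigma>b p0 L chi \<and> chi L > 0 \<longrightarrow>
                  (\<forall>l m. 1 \<le> m \<and> m \<le> l \<and> l \<le> L \<longrightarrow>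
                     \<bar>ln (chi m / chi l) - (A * (sqrt (real l) - sqrt (real m))
                                      + B * (ln (real l) - ln (real m)))\<bar> \<le> C)))"
proof (intro conjI impI, goal_cases)
  case 1
  \<comment> \<open>With \<open>\<sigma>w\<close> zero every backward factor is 1; the induction
    descends from \<open>L\<close>, the layer where \<open>chi\<close> is prescribed.\<close>
  have const: "chi n = chi L" if "frn_gradient tanh \<sigma>v \<sigma>a \<sigma>w \<sigma>b p0 L chi" "n \<le> L" for L chi n
    using that(2)
  proof (induction n rule: inc_induct)
    case (step n)
    have "Suc n \<in> {1..L}" using step by simp
    from that(1)[unfolded frn_gradient_def, rule_format, OF this]
    show ?case using step 1 by simp
  qed simp
  show ?case
  proof (intro allI impI)
    fix L chi l m assume g: "frn_gradient tanh \<sigma>v \<sigma>a \<sigma>w \<sigma>b p0 L chi" and "l \<le> L" "m \<le> L"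
    then show "chi m = chi l"
      using const[OF g, of m] const[OF g, of l] by simp
  qed
next
  case 2
  show ?case
  proof (cases "\<sigma>v = 0")
    \<comment> \<open>All backward factors are 1 and both coefficients are 0, so the witness 0
      works. This includes \<open>\<sigma>a\<close> equal to 0, where the denominators vanish and
      division by zero yields 0.\<close>
    case True
    have "ln (chi m / chi l) = 0"
      if "frn_gradient tanh \<sigma>v \<sigma>a \<sigma>w \<sigma>b p0 L chi" "chi L > 0" "m \<le> l" "l \<le> L" for L chi l m
      using ln_frn_gradient_ratio[OF that] True by simp
    then show ?thesis using True by (auto simp: Let_def intro!: exI[of _ 0])
  next
    case False
    with assms have "\<sigma>v > 0" by simp
    from tanh_gradient_asymp[OF assms(2,4,5) this] 2 obtain C where C:
      "\<And>l m. 1 \<le> m \<Longrightarrow> m \<le> l \<Longrightarrow>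
        \<bar>(\<Sum>n=m..<l. ln (1 + \<sigma>v\<^sup>2 * \<sigma>w\<^sup>2 * V_op (deriv tanh) (frn_q tanh \<sigma>v \<sigma>a \<sigma>w \<sigma>b p0 (Suc n))))
          - (4 / 3 * sqrt (2 / pi) * (\<sigma>v\<^sup>2 * \<sigma>w / sqrt (\<sigma>v\<^sup>2 + \<sigma>a\<^sup>2)) * (sqrt (real l) - sqrt (real m))
            + 4 / (9 * pi) * (\<sigma>v ^ 4 / (\<sigma>v\<^sup>2 + \<sigma>a\<^sup>2)) * (3 / (\<sigma>v\<^sup>2 + \<sigma>a\<^sup>2) - \<sigma>w\<^sup>2)
              * (ln (real l) - ln (real m)))\<bar> \<le> C"
      by blast
    show ?thesis
      unfolding Let_def
    proof (intro exI[of _ C] allI impI, elim conjE)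
      fix L chi l m
      assume "frn_gradient tanh \<sigma>v \<sigma>a \<sigma>w \<sigma>b p0 L chi" "0 < chi L" "1 \<le> m" "m \<le> l" "l \<le> L"
      then show "\<bar>ln (chi m / chi l)
          - (4 / 3 * sqrt (2 / pi) * (\<sigma>v\<^sup>2 * \<sigma>w / sqrt (\<sigma>v\<^sup>2 + \<sigma>a\<^sup>2)) * (sqrt (real l) - sqrt (real m))
            + 4 / (9 * pi) * (\<sigma>v ^ 4 / (\<sigma>v\<^sup>2 + \<sigma>a\<^sup>2)) * (3 / (\<sigma>v\<^sup>2 + \<sigma>a\<^sup>2) - \<sigma>w\<^sup>2)
              * (ln (real l) - ln (real m)))\<bar> \<le> C"
        using C[of m l] by (simp only: ln_frn_gradient_ratio)
    qed
  qed
qed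

end
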